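(* Let $k\in\{0,1,2,\dots\}$, let $I\subseteq\mathbb{R}$ be an interval, assume that $I$ is compact, and let $T\colon C^k(I)\to C(I)$ be an additive operator. Then the following conditions are pairwise equivalent: (i) $T(f\cdot g)=f\cdot T(g)+g\cdot T(f)$ for all $f,g\in C^k(I)$; (ii) $T(f\cdot g)=f\cdot T(g)+g\cdot T(f)$ for all $f,g\in C^k(I)$ with $f>0$ and $g>0$; (iii) $T(f^2)=2f\cdot T(f)$ for all $f\in C^k(I)$; (iv) $T(f^2)=2f\cdot T(f)$ for all $f\in C^k(I)$ with $f>0$; (v) $T(f)=-f^2\cdot T\left(\frac1f\right)$ for all $f\in C^k(I)$ with $f>0$; (vi) $T(f^n)=nf^{n-1}\cdot T(f)$ for all $f\in C^k(I)$ and all $n\in\mathbb{N}$; (vii) $T(f^n)=nf^{n-1}\cdot T(f)$ for all $f\in C^k(I)$ with $f>0$ and all $n\in\mathbb{N}$.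
   Context: $\mathbb{N}=\{1,2,\dots\}$. For an interval $I\subseteq\mathbb{R}$ and $k\in\{0,1,2,\dots\}$, $C^k(I)$ is the space of real-valued functions on $I$ that are $k$-times continuously differentiable on the interior of $I$; if $k=0$, one writes simply $C(I)$. The space $C^k(I)$ is furnished with the standard pointwise algebraic operations and is hence a real commutative algebra. An operator $T$ is additive if $T(f+g)=T(f)+T(g)$ for all $f,g$ in its domain. Inequalities such as $f>0$ are understood pointwise on $I$. *)

theory Defs
  imports "HOL-Analysis.Analysis"
begin

text \<open>\<open>f\<close> is \<open>k\<close>-times continuously differentiable on \<open>S\<close>; only used for open \<open>S\<close>,
  where \<^term>\<open>deriv\<close> is the usual derivative and depends only on the values of \<open>f\<close> on \<open>S\<close>.\<close>

primrec cont_diff_on :: "nat \<Rightarrow> real set \<Rightarrow> (real \<Rightarrow> real) \<Rightarrow> bool" where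
  "cont_diff_on 0 S f \<longleftrightarrow> continuous_on S f"
| "cont_diff_on (Suc k) S f \<longleftrightarrow> (\<forall>x\<in>S. f differentiable (at x)) \<and> cont_diff_on k S (deriv f)"

text \<open>A real-valued function on \<open>I\<close> is an element of \<^term>\<open>extensional I\<close>, so that two such functions
  are equal iff they agree on \<open>I\<close>; the pointwise algebraic operations are accordingly
  written with the restricted abstraction \<open>\<lambda>x\<in>I. _\<close>.

  Differentiability is required on the interior of \<open>I\<close> only. The extra argument \<open>E\<close> fixes the
  convention at the endpoints: \<open>E = interior I\<close> imposes nothing there (for every \<open>k\<close>, including
  \<open>k = 0\<close>, the condition is then just \<open>C\<^sup>k\<close> on the interior), whereas \<open>E = I\<close> also asks for
  continuity on all of \<open>I\<close>, so that \<open>C_space I I 0\<close> consists of all continuous functions on \<open>I\<close>.\<close>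

definition C_space :: "real set \<Rightarrow> real set \<Rightarrow> nat \<Rightarrow> (real \<Rightarrow> real) set" where
  "C_space E I k = {f \<in> extensional I. continuous_on E f \<and> cont_diff_on k (interior I) f}"

definition additive_operator ::
  "real set \<Rightarrow> (real \<Rightarrow> real) set \<Rightarrow> (real \<Rightarrow> real) set \<Rightarrow> ((real \<Rightarrow> real) \<Rightarrow> (real \<Rightarrow> real)) \<Rightarrow> bool"
  where
  "additive_operator I X Y T \<longleftrightarrow> T \<in> X \<rightarrow> Y \<and>
     (\<forall>f\<in>X. \<forall>g\<in>X. T (\<lambda>x\<in>I. f x + g x) = (\<lambda>x\<in>I. T f x + T g x))"

end

theory Submission
  imports Defs
begin

text \<open>Everything is algebra in \<open>C\<^sup>k(I)\<close> as a ring of functions that contains the reciprocals of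
  its positive elements. Polarization turns (iv) into (ii). Since \<open>f = (f\<^sup>2 + 1 + f) - (f\<^sup>2 + 1)\<close>
  is a difference of positive elements and the Leibniz defect is biadditive, (ii) gives (i).
  (Adding a constant to \<open>f\<close> would not do: for \<open>E = interior I\<close> the functions may be unbounded.)
  Applying \<open>T\<close> and (v) to \<open>1/f - 1/(f + 1) = 1/(f\<^sup>2 + f)\<close> gives (iv).\<close>

section \<open>Closure of \<open>k\<close>-fold continuous differentiability under the ring
  operations and reciprocals\<close>

lemma cont_diff_on_cong:
  assumes "open S" "\<And>x. x \<in> S \<Longrightarrow> f x = g x" "cont_diff_on k S f"
  shows "cont_diff_on k S g"
  using assms(2,3)
proof (induction k arbitrary: f g)
  case 0
  then show ?case
    using continuous_on_cong[of S S f g] by auto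
next
  case (Suc k)
  \<comment> \<open>Openness of \<open>S\<close> turns agreement on \<open>S\<close> into agreement
    near each of its points, which is what derivatives see.\<close>
  have eq: "eventually (\<lambda>y. f y = g y) (nhds x)" if "x \<in> S" for x
    using that \<open>open S\<close> Suc.prems(1) by (auto simp: eventually_nhds)
  have "deriv f x = deriv g x" if "x \<in> S" for x
    using deriv_cong_ev[OF eq[OF that]] by simp
  moreover have "g differentiable (at x)" if "x \<in> S" for x
  proof -
    have "(f has_field_derivative deriv f x) (at x)"
      using Suc.prems(2) that by (auto simp: DERIV_deriv_iff_real_differentiable)
    then have "(g has_field_derivative deriv f x) (at x)"
      using DERIV_cong_ev[OF refl eq[OF that] refl] by blast
    then show ?thesis
      by (auto simp: real_differentiable_def)
  qed
  ultimately show ?case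
    using Suc.IH[of "deriv f" "deriv g"] Suc.prems(2) by auto
qed

text \<open>Lets an explicit formula \<open>f'\<close> replace \<open>deriv f\<close>: the two agree
  on the open set \<open>S\<close>, and this suffices by \<open>cont_diff_on_cong\<close>.\<close>

lemma cont_diff_on_SucI:
  assumes "open S" "\<And>x. x \<in> S \<Longrightarrow> (f has_field_derivative f' x) (at x)" "cont_diff_on k S f'"
  shows "cont_diff_on (Suc k) S f"
proof -
  have "f differentiable (at x)" if "x \<in> S" for x
    using assms(2)[OF that] real_differentiable_def by blast
  moreover have "f' x = deriv f x" if "x \<in> S" for x
    using DERIV_imp_deriv[OF assms(2)[OF that]] by simp
  ultimately show ?thesis
    using cont_diff_on_cong[OF assms(1) _ assms(3)] by auto
qed

lemma cont_diff_on_Suc_deriv: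
  assumes "cont_diff_on (Suc k) S f" "x \<in> S"
  shows "(f has_field_derivative deriv f x) (at x)"
  using assms by (auto simp: DERIV_deriv_iff_real_differentiable)

text \<open>Needed for products and reciprocals, whose derivatives contain the undifferentiated
  functions as factors: these have order \<open>Suc k\<close> and must be used at order
  \<open>k\<close>.\<close>

lemma cont_diff_on_Suc_imp:
  "cont_diff_on (Suc k) S f \<Longrightarrow> cont_diff_on k S f"
proof (induction k arbitrary: f)
  case 0
  then have "isCont f x" if "x \<in> S" for x
    using DERIV_isCont cont_diff_on_Suc_deriv that by blast
  then show ?case
    by (simp add: continuous_at_imp_continuous_on)
qed auto

lemma cont_diff_on_const:
  assumes "open S"
  shows "cont_diff_on k S (\<lambda>x. c)"
proof (induction k arbitrary: c)
  case (Suc k)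
  show ?case
    by (rule cont_diff_on_SucI[OF assms, where f' = "\<lambda>x. 0"]) (use Suc in auto)
qed auto

lemma cont_diff_on_add:
  assumes "open S" "cont_diff_on k S f" "cont_diff_on k S g"
  shows "cont_diff_on k S (\<lambda>x. f x + g x)"
  using assms(2,3)
proof (induction k arbitrary: f g)
  case 0
  then show ?case by (auto intro: continuous_intros)
next
  case (Suc k)
  show ?case
  proof (rule cont_diff_on_SucI[OF assms(1), where f' = "\<lambda>x. deriv f x + deriv g x"])
    show "((\<lambda>x. f x + g x) has_field_derivative deriv f x + deriv g x) (at x)" if "x \<in> S" for x
      using Suc.prems[THEN cont_diff_on_Suc_deriv[OF _ that]] by (intro DERIV_add)
  qed (use Suc in auto)
qed

lemma cont_diff_on_mult:
  assumes "open S" "cont_diff_on k S f" "cont_diff_on k S g"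
  shows "cont_diff_on k S (\<lambda>x. f x * g x)"
  using assms(2,3)
proof (induction k arbitrary: f g)
  case 0
  then show ?case by (auto intro: continuous_intros)
next
  case (Suc k)
  show ?case
  proof (rule cont_diff_on_SucI[OF assms(1), where f' = "\<lambda>x. deriv f x * g x + deriv g x * f x"])
    show "((\<lambda>x. f x * g x) has_field_derivative deriv f x * g x + deriv g x * f x) (at x)"
      if "x \<in> S" for x
      using Suc.prems[THEN cont_diff_on_Suc_deriv[OF _ that]] by (intro DERIV_mult)
    show "cont_diff_on k S (\<lambda>x. deriv f x * g x + deriv g x * f x)"
      using Suc.prems Suc.prems[THEN cont_diff_on_Suc_imp]
      by (intro cont_diff_on_add[OF assms(1)] Suc.IH) auto
  qed
qed

lemma cont_diff_on_inverse:
  assumes "open S" "cont_diff_on k S f" "\<And>x. x \<in> S \<Longrightarrow> f x \<noteq> 0"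
  shows "cont_diff_on k S (\<lambda>x. inverse (f x))"
  using assms(2)
proof (induction k)
  case 0
  then show ?case using assms(3) by (auto intro: continuous_intros)
next
  case (Suc k)
  have inv: "cont_diff_on k S (\<lambda>x. inverse (f x))"
    using Suc cont_diff_on_Suc_imp by blast
  show ?case
  \<comment> \<open>The derivative is written as a product with the constant \<open>-1\<close>, so
    that closure under products and constants covers it; its factor \<open>inverse (f x)\<close> has
    order \<open>k\<close> by the induction hypothesis.\<close>
  proof (rule cont_diff_on_SucI[OF assms(1),
        where f' = "\<lambda>x. (-1) * (inverse (f x) * deriv f x * inverse (f x))"])
    show "((\<lambda>x. inverse (f x)) has_field_derivative
        (-1) * (inverse (f x) * deriv f x * inverse (f x))) (at x)" if "x \<in> S" for x
      using DERIV_inverse'[OF cont_diff_on_Suc_deriv[OF Suc.prems that] assms(3)[OF that]] by simp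
    show "cont_diff_on k S (\<lambda>x. (-1) * (inverse (f x) * deriv f x * inverse (f x)))"
      using inv Suc.prems
      by (intro cont_diff_on_mult cont_diff_on_const assms(1)) auto
  qed
qed

text \<open>Passing to the restricted abstraction changes no value on \<open>I\<close>, hence
  neither continuity on \<open>E\<close> nor any derivative on the open set
  \<open>interior I\<close>.\<close>

lemma C_space_restrict:
  assumes "E \<subseteq> I" "interior I \<subseteq> E" "continuous_on E f" "cont_diff_on k (interior I) f"
  shows "restrict f I \<in> C_space E I k"
proof -
  have "continuous_on E (restrict f I)"
    using continuous_on_cong[of E E f "restrict f I"] assms by (auto simp: subset_iff)
  moreover have "cont_diff_on k (interior I) (restrict f I)"
    using cont_diff_on_cong[of "interior I" f "restrict f I"] assms by (auto simp: subset_iff)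
  ultimately show ?thesis
    by (auto simp: C_space_def)
qed

section \<open>Additive operators on rings of functions\<close>

text \<open>Collects what the algebraic argument uses, so that both endpoint conventions are handled
  at once. \<open>ext\<close> and \<open>T_ext\<close> reduce equality of functions to equality at
  the points of \<open>I\<close>.\<close>

locale additive_on_function_ring =
  fixes I :: "'a set" and A :: "('a \<Rightarrow> real) set" and T :: "('a \<Rightarrow> real) \<Rightarrow> 'a \<Rightarrow> real"
  assumes ext: "f \<in> A \<Longrightarrow> f \<in> extensional I"
    and const: "(\<lambda>x\<in>I. c) \<in> A"
    and add: "f \<in> A \<Longrightarrow> g \<in> A \<Longrightarrow> (\<lambda>x\<in>I. f x + g x) \<in> A"
    and mult: "f \<in> A \<Longrightarrow> g \<in> A \<Longrightarrow> (\<lambda>x\<in>I. f x * g x) \<in> A"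
    and recip: "f \<in> A \<Longrightarrow> \<forall>x\<in>I. f x > 0 \<Longrightarrow> (\<lambda>x\<in>I. 1 / f x) \<in> A"
    and T_ext: "f \<in> A \<Longrightarrow> T f \<in> extensional I"
    and T_add: "f \<in> A \<Longrightarrow> g \<in> A \<Longrightarrow> T (\<lambda>x\<in>I. f x + g x) = (\<lambda>x\<in>I. T f x + T g x)"
begin

lemma T_eqI: "f \<in> A \<Longrightarrow> (\<And>x. x \<in> I \<Longrightarrow> T f x = h x) \<Longrightarrow> T f = (\<lambda>x\<in>I. h x)"
  by (rule extensionalityI[OF T_ext]) auto

text \<open>Extensionality identifies \<open>h\<close> with the restricted sum, so additivity
  applies to functions written in any form, such as \<open>(f + g)^2\<close> in expanded
  shape.\<close>

lemma T_sum:
  assumes "f \<in> A" "g \<in> A" "h \<in> A" "\<And>x. x \<in> I \<Longrightarrow> h x = f x + g x" "x \<in> I"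
  shows "T h x = T f x + T g x"
proof -
  have "h = (\<lambda>x\<in>I. f x + g x)"
    by (rule extensionalityI[OF ext[OF assms(3)]]) (use assms(4) in auto)
  then show ?thesis
    using T_add assms by simp
qed

lemma square: "f \<in> A \<Longrightarrow> (\<lambda>x\<in>I. (f x)\<^sup>2) \<in> A"
  using mult by (simp add: power2_eq_square)

lemma power: "f \<in> A \<Longrightarrow> (\<lambda>x\<in>I. f x ^ n) \<in> A"
proof (induction n)
  case (Suc n)
  have "(\<lambda>x\<in>I. f x ^ Suc n) = (\<lambda>x\<in>I. f x * (\<lambda>x\<in>I. f x ^ n) x)"
    by auto
  then show ?case
    using mult[OF Suc.prems Suc.IH[OF Suc.prems]] by (simp only:)
qed (simp add: const)

section \<open>The Leibniz rule and its reduction to positive functions\<close>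

text \<open>Kept as an equation of functions, the form of (i) and (ii), so that unfolding it
  recovers these conditions literally.\<close>

definition leibniz :: "('a \<Rightarrow> real) \<Rightarrow> ('a \<Rightarrow> real) \<Rightarrow> bool" where
  "leibniz f g \<longleftrightarrow> T (\<lambda>x\<in>I. f x * g x) = (\<lambda>x\<in>I. f x * T g x + g x * T f x)"

lemma leibniz_iff:
  "f \<in> A \<Longrightarrow> g \<in> A \<Longrightarrow>
    leibniz f g \<longleftrightarrow> (\<forall>x\<in>I. T (\<lambda>x\<in>I. f x * g x) x = f x * T g x + g x * T f x)"
  unfolding leibniz_def by (rule iffI, simp, rule T_eqI[OF mult]) blast+

lemma leibniz_commute: "leibniz f g \<longleftrightarrow> leibniz g f"
  by (simp add: leibniz_def mult.commute add.commute)

text \<open>The defect \<open>T(f g) - f T(g) - g T(f)\<close> is additive in \<open>f\<close>; if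
  it vanishes at \<open>p\<close> and \<open>q\<close>, it vanishes at \<open>f = p - q\<close>. The
  difference is expressed as \<open>p = f + q\<close> because additivity of \<open>T\<close> speaks
  of sums.\<close>

lemma leibniz_cancel_left:
  assumes A: "f \<in> A" "p \<in> A" "q \<in> A" "g \<in> A"
    and eq: "\<And>x. x \<in> I \<Longrightarrow> p x = f x + q x"
    and pg: "leibniz p g" and qg: "leibniz q g"
  shows "leibniz f g"
  unfolding leibniz_iff[OF A(1,4)]
proof
  fix x assume x: "x \<in> I"
  have "T (\<lambda>x\<in>I. p x * g x) x = T (\<lambda>x\<in>I. f x * g x) x + T (\<lambda>x\<in>I. q x * g x) x"
    by (rule T_sum) (use A eq x in \<open>auto intro: mult simp: algebra_simps\<close>)
  moreover have "T p x = T f x + T q x"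
    by (rule T_sum) (use A eq x in auto)
  ultimately show "T (\<lambda>x\<in>I. f x * g x) x = f x * T g x + g x * T f x"
    using pg qg x eq[OF x] A by (simp add: leibniz_iff algebra_simps)
qed

lemma positive_difference:
  assumes "f \<in> A"
  obtains p q where "p \<in> A" "q \<in> A" "\<forall>x\<in>I. p x > 0" "\<forall>x\<in>I. q x > 0"
    "\<And>x. x \<in> I \<Longrightarrow> p x = f x + q x"
proof -
  define q where "q = (\<lambda>x\<in>I. (\<lambda>x\<in>I. (f x)\<^sup>2) x + (\<lambda>x\<in>I. 1) x)"
  define p where "p = (\<lambda>x\<in>I. f x + q x)"
  have q: "q \<in> A"
    unfolding q_def by (intro add square const assms)
  have p: "p \<in> A"
    unfolding p_def by (intro add q assms)
  have "f x + ((f x)\<^sup>2 + 1) > 0" for x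
  proof -
    have "f x + ((f x)\<^sup>2 + 1) = (f x + 1/2)\<^sup>2 + 3/4"
      by (simp add: power2_eq_square algebra_simps)
    then show ?thesis
      using zero_le_power2[of "f x + 1/2"] by linarith
  qed
  then have "\<forall>x\<in>I. p x > 0"
    by (simp add: p_def q_def)
  moreover have "\<forall>x\<in>I. q x > 0"
    by (simp add: q_def add_nonneg_pos)
  ultimately show thesis
    using that p q by (simp add: p_def)
qed

lemma leibniz_if_leibniz_positive:
  assumes "\<And>f g. f \<in> A \<Longrightarrow> g \<in> A \<Longrightarrow> \<forall>x\<in>I. f x > 0 \<Longrightarrow> \<forall>x\<in>I. g x > 0 \<Longrightarrow> leibniz f g"
    and "f \<in> A" "g \<in> A"
  shows "leibniz f g"
proof -
  \<comment> \<open>First the positivity of the left factor is removed, with the right one still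
    positive.\<close>
  have half: "leibniz f g" if f: "f \<in> A" and g: "g \<in> A" "\<forall>x\<in>I. g x > 0" for f g
  proof -
    obtain p q where pq: "p \<in> A" "q \<in> A" "\<forall>x\<in>I. p x > 0" "\<forall>x\<in>I. q x > 0"
      and eq: "\<And>x. x \<in> I \<Longrightarrow> p x = f x + q x"
      using positive_difference[OF f] by blast
    show ?thesis
      by (rule leibniz_cancel_left[OF f pq(1,2) g(1) eq]) (use assms(1) pq g in auto)
  qed
  obtain p q where pq: "p \<in> A" "q \<in> A" "\<forall>x\<in>I. p x > 0" "\<forall>x\<in>I. q x > 0"
    and eq: "\<And>x. x \<in> I \<Longrightarrow> p x = g x + q x"
    using positive_difference[OF assms(3)] by blast
  \<comment> \<open>By symmetry \<open>half\<close> gives the rule for the pairs \<open>p\<close>,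
    \<open>f\<close> and \<open>q\<close>, \<open>f\<close>, so the same cancellation removes the
    positivity of the other factor.\<close>
  have "leibniz g f"
    by (rule leibniz_cancel_left[OF assms(3) pq(1,2) assms(2) eq])
      (use half assms(2) pq leibniz_commute in auto)
  then show ?thesis
    using leibniz_commute by blast
qed

section \<open>Squares, reciprocals and powers\<close>

text \<open>Evaluate \<open>T((f + g)^2)\<close> by the square rule and by expanding the square,
  then compare. Only three squares enter; for positive \<open>f\<close> and \<open>g\<close> all
  three bases are positive, so (iv) supplies them.\<close>

lemma leibniz_if_squares:
  assumes A: "f \<in> A" "g \<in> A"
    and T_sq: "\<And>h x. h \<in> {f, g, \<lambda>x\<in>I. f x + g x} \<Longrightarrow> x \<in> I \<Longrightarrow> T (\<lambda>x\<in>I. (h x)\<^sup>2) x = 2 * h x * T h x"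
  shows "leibniz f g"
  unfolding leibniz_iff[OF A]
proof
  fix x assume x: "x \<in> I"
  let ?s = "\<lambda>x\<in>I. f x + g x" and ?fg = "\<lambda>x\<in>I. f x * g x"
  \<comment> \<open>The mixed term \<open>2 f g\<close> is the sum \<open>fg + fg\<close>, to which
    additivity applies directly; the factor 2 cancels at the end.\<close>
  let ?sq = "\<lambda>x\<in>I. (\<lambda>x\<in>I. (f x)\<^sup>2) x + (\<lambda>x\<in>I. (g x)\<^sup>2) x" and ?m = "\<lambda>x\<in>I. ?fg x + ?fg x"
  have s: "?s \<in> A" and m: "?m \<in> A" and sq: "?sq \<in> A"
    by (intro add mult square A)+
  have "T (\<lambda>x\<in>I. (?s x)\<^sup>2) x = T ?sq x + T ?m x"
    by (rule T_sum[OF sq m square[OF s] _ x]) (simp add: power2_eq_square algebra_simps)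
  moreover have "T ?sq x = T (\<lambda>x\<in>I. (f x)\<^sup>2) x + T (\<lambda>x\<in>I. (g x)\<^sup>2) x"
    by (rule T_sum[OF square[OF A(1)] square[OF A(2)] sq _ x]) simp
  moreover have "T ?m x = T ?fg x + T ?fg x"
    by (rule T_sum[OF mult[OF A] mult[OF A] m _ x]) simp
  moreover have "T ?s x = T f x + T g x"
    by (rule T_sum[OF A s _ x]) simp
  ultimately show "T ?fg x = f x * T g x + g x * T f x"
    using T_sq[of f x] T_sq[of g x] T_sq[of ?s x] x by (simp add: algebra_simps)
qed

text \<open>Applying the rule to \<open>1 * 1 = 1\<close> gives
  \<open>T(1) = 2 T(1)\<close>.\<close>

lemma T_one_if_leibniz:
  assumes "leibniz (\<lambda>x\<in>I. 1) (\<lambda>x\<in>I. 1)" "x \<in> I"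
  shows "T (\<lambda>x\<in>I. 1) x = 0"
proof -
  have "(\<lambda>x\<in>I. (\<lambda>x\<in>I. 1) x * (\<lambda>x\<in>I. 1) x) = (\<lambda>x\<in>I. 1 :: real)"
    by auto
  then show ?thesis
    using assms leibniz_iff[OF const const, of 1 1] by auto
qed

text \<open>Apply \<open>T\<close> to \<open>f * (1/f) = 1\<close> and use \<open>T(1) = 0\<close>.
  Both Leibniz instances concern positive functions, so (ii) provides them.\<close>

lemma T_reciprocal_if_leibniz:
  assumes f: "f \<in> A" "\<forall>x\<in>I. f x > 0"
    and "leibniz (\<lambda>x\<in>I. 1) (\<lambda>x\<in>I. 1)" "leibniz f (\<lambda>x\<in>I. 1 / f x)"
  shows "T f = (\<lambda>x\<in>I. - (f x)\<^sup>2 * T (\<lambda>y\<in>I. 1 / f y) x)"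
proof (rule T_eqI[OF f(1)])
  fix x assume x: "x \<in> I"
  have "(\<lambda>x\<in>I. f x * (\<lambda>x\<in>I. 1 / f x) x) = (\<lambda>x\<in>I. 1)"
    using f(2) by fastforce
  then have "f x * T (\<lambda>x\<in>I. 1 / f x) x + 1 / f x * T f x = 0"
    using assms(4) T_one_if_leibniz[OF assms(3) x] x leibniz_iff[OF f(1) recip[OF f]] by simp
  moreover have "f x \<noteq> 0"
    using f(2) x by auto
  ultimately show "T f x = - (f x)\<^sup>2 * T (\<lambda>y\<in>I. 1 / f y) x"
    by (simp add: field_simps power2_eq_square)
qed

text \<open>At a point put \<open>a = f\<close>, \<open>u = T(f)\<close> and
  \<open>v = T(f^2 + f)\<close>. Then (v) turns the partial fraction identity into
  \<open>u/a^2 = u/(a+1)^2 + v/(a(a+1))^2\<close>, so \<open>v = (2a+1)u\<close>, and subtracting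
  \<open>u\<close> leaves \<open>T(f^2) = 2au\<close>.\<close>

lemma T_square_if_reciprocals:
  assumes rc: "\<And>f x. f \<in> A \<Longrightarrow> \<forall>x\<in>I. f x > 0 \<Longrightarrow> x \<in> I \<Longrightarrow>
      T f x = - (f x)\<^sup>2 * T (\<lambda>y\<in>I. 1 / f y) x"
    and f: "f \<in> A" "\<forall>x\<in>I. f x > 0" and x: "x \<in> I"
  shows "T (\<lambda>x\<in>I. (f x)\<^sup>2) x = 2 * f x * T f x"
proof -
  let ?one = "\<lambda>x\<in>I. 1 :: real"
  let ?s = "\<lambda>x\<in>I. f x + ?one x"
  let ?p = "\<lambda>x\<in>I. (\<lambda>x\<in>I. (f x)\<^sup>2) x + f x"
  let ?r = "\<lambda>h. \<lambda>x\<in>I. 1 / h x :: real"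
  have s: "?s \<in> A" "\<forall>x\<in>I. ?s x > 0"
    using f(2) add[OF f(1) const[of 1]] by (simp_all add: add_pos_pos)
  have p: "?p \<in> A" "\<forall>x\<in>I. ?p x > 0"
    using f(2) add[OF square f(1)] f(1) by (simp_all add: add_nonneg_pos)
  \<comment> \<open>For the constant 1, which is its own reciprocal, (v) reads
    \<open>T(1) = -T(1)\<close>. Hence \<open>f\<close> and \<open>f + 1\<close> have the same image
    at \<open>x\<close>.\<close>
  have "(\<lambda>y\<in>I. 1 / ?one y) = ?one"
    by auto
  then have one: "T ?one x = 0"
    using rc[OF const[of 1] _ x] x by simp
  have Ts: "T ?s x = T f x"
    using T_sum[OF f(1) const[of 1] s(1) _ x] one by simp
  have Tp: "T ?p x = T (\<lambda>x\<in>I. (f x)\<^sup>2) x + T f x"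
    by (rule T_sum) (use x f p square in auto)
  have r: "T (?r f) x = T (?r ?s) x + T (?r ?p) x"
  proof (rule T_sum[OF recip[OF s] recip[OF p] recip[OF f] _ x])
    fix y assume "y \<in> I"
    then have "f y > 0"
      using f by auto
    then have "f y + 1 \<noteq> 0" "f y \<noteq> 0" "(f y)\<^sup>2 + f y = f y * (f y + 1)"
      by (auto simp: power2_eq_square algebra_simps)
    then show "?r f y = ?r ?s y + ?r ?p y"
      using \<open>y \<in> I\<close> by (simp add: divide_simps)
  qed
  define a u v where "a = f x" and "u = T f x" and "v = T ?p x"
  have a: "a > 0"
    using f x by (simp add: a_def)
  \<comment> \<open>This is (v) solved for the value at the reciprocal.\<close>
  have rc': "T (?r h) x = - T h x / (h x)\<^sup>2" if "h \<in> A" "\<forall>x\<in>I. h x > 0" for h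
  proof -
    have "h x \<noteq> 0"
      using that(2) x by force
    then show ?thesis
      using rc[OF that x] by (simp add: field_simps)
  qed
  have "?s x = a + 1" "?p x = a * (a + 1)"
    using x by (simp_all add: a_def power2_eq_square algebra_simps)
  then have "T (?r f) x = - u / a\<^sup>2" "T (?r ?s) x = - u / (a + 1)\<^sup>2"
    "T (?r ?p) x = - v / (a * (a + 1))\<^sup>2"
    unfolding rc'[OF f] rc'[OF s] rc'[OF p] Ts by (simp_all only: u_def v_def a_def)
  then have "v / (a * (a + 1))\<^sup>2 = u / a\<^sup>2 - u / (a + 1)\<^sup>2"
    using r by linarith
  also have "\<dots> = u * (2 * a + 1) / (a * (a + 1))\<^sup>2"
  proof -
    have "u / a\<^sup>2 - u / (a + 1)\<^sup>2 = (u * (a + 1)\<^sup>2 - u * a\<^sup>2) / (a\<^sup>2 * (a + 1)\<^sup>2)"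
      using a by (simp add: diff_frac_eq)
    also have "u * (a + 1)\<^sup>2 - u * a\<^sup>2 = u * (2 * a + 1)"
      by (simp add: power2_eq_square algebra_simps)
    finally show ?thesis
      by (simp add: power_mult_distrib)
  qed
  finally have "v = u * (2 * a + 1)"
    using a by simp
  then show ?thesis
    using Tp by (simp add: u_def v_def a_def algebra_simps)
qed

text \<open>Induction along \<open>f^(n+1) = f * f^n\<close>: the first factor stays
  \<open>f\<close>, while the second runs through the powers of \<open>f\<close>.\<close>

lemma T_power_if_leibniz:
  assumes L: "\<And>g. g \<in> A \<Longrightarrow> leibniz f g" and f: "f \<in> A" and "n \<ge> 1"
  shows "T (\<lambda>x\<in>I. f x ^ n) = (\<lambda>x\<in>I. real n * f x ^ (n - 1) * T f x)"
  using \<open>n \<ge> 1\<close>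
proof (induction n rule: dec_induct)
  case base
  have "(\<lambda>x\<in>I. f x) = f"
    using ext[OF f] by (rule extensional_restrict)
  then show ?case
    using T_eqI[OF f, of "T f"] by simp
next
  case (step n)
  let ?p = "\<lambda>x\<in>I. f x ^ n"
  have "(\<lambda>x\<in>I. f x ^ Suc n) = (\<lambda>x\<in>I. f x * ?p x)"
    by auto
  then have "T (\<lambda>x\<in>I. f x ^ Suc n) = (\<lambda>x\<in>I. f x * T ?p x + ?p x * T f x)"
    using L[OF power[OF f]] by (simp add: leibniz_def)
  also have "\<dots> = (\<lambda>x\<in>I. real (Suc n) * f x ^ (Suc n - 1) * T f x)"
  proof (rule restrict_ext)
    fix x assume "x \<in> I"
    \<comment> \<open>Here \<open>n \<ge> 1\<close> matters, since subtraction on naturals is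
      truncated at 0.\<close>
    moreover have "f x * f x ^ (n - 1) = f x ^ n"
      using step.hyps by (simp flip: power_Suc)
    then have "f x * (real n * f x ^ (n - 1) * T f x) = real n * f x ^ n * T f x"
      by (simp add: ac_simps)
    ultimately show "f x * T ?p x + ?p x * T f x = real (Suc n) * f x ^ (Suc n - 1) * T f x"
      by (simp add: step.IH algebra_simps)
  qed
  finally show ?case .
qed

end

section \<open>Application to \<open>C_space\<close> and the equivalence of the seven
  conditions\<close>

text \<open>Either choice of \<open>E\<close> lies between \<open>interior I\<close> and
  \<open>I\<close>, so the closure properties follow from those of continuous and of
  \<open>k\<close>-times continuously differentiable functions. A function positive on
  \<open>I\<close> vanishes nowhere on \<open>E\<close> or \<open>interior I\<close>.\<close>

lemma additive_on_C_space:
  assumes E: "E = interior I \<or> E = I"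
    and T: "additive_operator I (C_space E I k) (C_space E I 0) T"
  shows "additive_on_function_ring I (C_space E I k) T"
proof
  have sub: "E \<subseteq> I" "interior I \<subseteq> E"
    using E interior_subset by auto
  note restr = C_space_restrict[OF sub]
  show "(\<lambda>x\<in>I. c) \<in> C_space E I k" for c
    by (intro restr cont_diff_on_const) auto
  show "f \<in> extensional I" if "f \<in> C_space E I k" for f
    using that by (simp add: C_space_def)
  show "(\<lambda>x\<in>I. f x + g x) \<in> C_space E I k" if "f \<in> C_space E I k" "g \<in> C_space E I k" for f g
    using that by (intro restr cont_diff_on_add continuous_on_add) (auto simp: C_space_def)
  show "(\<lambda>x\<in>I. f x * g x) \<in> C_space E I k" if "f \<in> C_space E I k" "g \<in> C_space E I k" for f g
    using that by (intro restr cont_diff_on_mult continuous_on_mult) (auto simp: C_space_def)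
  show "(\<lambda>x\<in>I. 1 / f x) \<in> C_space E I k" if f: "f \<in> C_space E I k" "\<forall>x\<in>I. f x > 0" for f
  proof -
    have "f x \<noteq> 0" if "x \<in> I" for x
      using f(2) that by force
    then have "(\<lambda>x\<in>I. inverse (f x)) \<in> C_space E I k"
      using f(1) sub
      by (intro restr cont_diff_on_inverse continuous_on_inverse) (auto simp: C_space_def)
    then show ?thesis
      by (simp add: inverse_eq_divide)
  qed
  show "T f \<in> extensional I" if "f \<in> C_space E I k" for f
    using T that by (auto simp: additive_operator_def C_space_def)
  show "T (\<lambda>x\<in>I. f x + g x) = (\<lambda>x\<in>I. T f x + T g x)"
    if "f \<in> C_space E I k" "g \<in> C_space E I k" for f g
    using T that by (simp add: additive_operator_def)
qed

theorem theorem4: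
  fixes k :: nat and I E :: "real set" and T :: "(real \<Rightarrow> real) \<Rightarrow> (real \<Rightarrow> real)"
  assumes "is_interval I" and "compact I"
    and "E = interior I \<or> E = I"
    and "additive_operator I (C_space E I k) (C_space E I 0) T"
  shows "let conditions =
    [ (\<forall>f\<in>C_space E I k. \<forall>g\<in>C_space E I k.
         T (\<lambda>x\<in>I. f x * g x) = (\<lambda>x\<in>I. f x * T g x + g x * T f x)),
      (\<forall>f\<in>C_space E I k. \<forall>g\<in>C_space E I k. (\<forall>x\<in>I. f x > 0) \<and> (\<forall>x\<in>I. g x > 0) \<longrightarrow>
         T (\<lambda>x\<in>I. f x * g x) = (\<lambda>x\<in>I. f x * T g x + g x * T f x)),
      (\<forall>f\<in>C_space E I k.
         T (\<lambda>x\<in>I. (f x)\<^sup>2) = (\<lambda>x\<in>I. 2 * f x * T f x)),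
      (\<forall>f\<in>C_space E I k. (\<forall>x\<in>I. f x > 0) \<longrightarrow>
         T (\<lambda>x\<in>I. (f x)\<^sup>2) = (\<lambda>x\<in>I. 2 * f x * T f x)),
      (\<forall>f\<in>C_space E I k. (\<forall>x\<in>I. f x > 0) \<longrightarrow>
         T f = (\<lambda>x\<in>I. - (f x)\<^sup>2 * T (\<lambda>y\<in>I. 1 / f y) x)),
      (\<forall>f\<in>C_space E I k. \<forall>n::nat. n \<ge> 1 \<longrightarrow>
         T (\<lambda>x\<in>I. f x ^ n) = (\<lambda>x\<in>I. real n * f x ^ (n - 1) * T f x)),
      (\<forall>f\<in>C_space E I k. (\<forall>x\<in>I. f x > 0) \<longrightarrow> (\<forall>n::nat. n \<ge> 1 \<longrightarrow>
         T (\<lambda>x\<in>I. f x ^ n) = (\<lambda>x\<in>I. real n * f x ^ (n - 1) * T f x))) ]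
    in \<forall>P \<in> set conditions. \<forall>Q \<in> set conditions. P \<longleftrightarrow> Q"
proof -
  let ?A = "C_space E I k"
  interpret additive_on_function_ring I ?A T
    by (rule additive_on_C_space[OF assms(3,4)])
  let ?pos = "\<lambda>f. \<forall>x\<in>I. f x > (0 :: real)"
  let ?sq = "\<lambda>f. T (\<lambda>x\<in>I. (f x)\<^sup>2) = (\<lambda>x\<in>I. 2 * f x * T f x)"
  let ?rc = "\<lambda>f. T f = (\<lambda>x\<in>I. - (f x)\<^sup>2 * T (\<lambda>y\<in>I. 1 / f y) x)"
  let ?pw = "\<lambda>f. \<forall>n::nat. n \<ge> 1 \<longrightarrow> T (\<lambda>x\<in>I. f x ^ n) = (\<lambda>x\<in>I. real n * f x ^ (n - 1) * T f x)"
  \<comment> \<open>Naming the conditions makes them atoms, so the final combination of implications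
    is purely propositional.\<close>
  define c1 c2 c3 c4 c5 c6 c7 where
    c1: "c1 \<longleftrightarrow> (\<forall>f\<in>?A. \<forall>g\<in>?A. leibniz f g)" and
    c2: "c2 \<longleftrightarrow> (\<forall>f\<in>?A. \<forall>g\<in>?A. ?pos f \<and> ?pos g \<longrightarrow> leibniz f g)" and
    c3: "c3 \<longleftrightarrow> (\<forall>f\<in>?A. ?sq f)" and
    c4: "c4 \<longleftrightarrow> (\<forall>f\<in>?A. ?pos f \<longrightarrow> ?sq f)" and
    c5: "c5 \<longleftrightarrow> (\<forall>f\<in>?A. ?pos f \<longrightarrow> ?rc f)" and
    c6: "c6 \<longleftrightarrow> (\<forall>f\<in>?A. ?pw f)" and
    c7: "c7 \<longleftrightarrow> (\<forall>f\<in>?A. ?pos f \<longrightarrow> ?pw f)"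
  have pw_sq: "?sq f" if "?pw f" for f
    using that[THEN spec, of 2] by simp
  \<comment> \<open>The implications are (i) to (vi) to (iii) to (iv), (vi) to (vii) to (iv), (iv)
    to (ii) to (i), and (ii) to (v) to (iv); every condition is thus reached from every
    other.\<close>
  have "c1 \<Longrightarrow> c6"
    unfolding c1 c6 using T_power_if_leibniz by blast
  moreover have "c6 \<Longrightarrow> c3"
    unfolding c6 c3 using pw_sq by blast
  moreover have "c3 \<Longrightarrow> c4"
    unfolding c3 c4 by blast
  moreover have "c6 \<Longrightarrow> c7"
    unfolding c6 c7 by blast
  moreover have "c7 \<Longrightarrow> c4"
    unfolding c7 c4 using pw_sq by blast
  moreover have c2 if c4
    unfolding c2
  proof (intro ballI impI)
    fix f g assume fg: "f \<in> ?A" "g \<in> ?A" "?pos f \<and> ?pos g"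
    have sq: "?sq h" if "h \<in> {f, g, \<lambda>x\<in>I. f x + g x}" for h
    proof -
      have "h \<in> ?A" "?pos h"
        using that fg add by (auto simp: add_pos_pos)
      then show ?thesis
        using \<open>c4\<close> unfolding c4 by blast
    qed
    show "leibniz f g"
      by (rule leibniz_if_squares[OF fg(1,2)]) (simp add: sq)
  qed
  moreover have "c2 \<Longrightarrow> c1"
    unfolding c1 c2 using leibniz_if_leibniz_positive by blast
  moreover have c5 if c2
    unfolding c5
  proof (intro ballI impI)
    fix f assume f: "f \<in> ?A" "?pos f"
    \<comment> \<open>It is used for the pairs \<open>1\<close>, \<open>1\<close> and
      \<open>f\<close>, \<open>1/f\<close>, all of them positive.\<close>
    have L: "leibniz g h" if "g \<in> ?A" "h \<in> ?A" "?pos g" "?pos h" for g h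
      using \<open>c2\<close> that unfolding c2 by blast
    show "?rc f"
      by (rule T_reciprocal_if_leibniz[OF f]; rule L) (use f const recip in auto)
  qed
  moreover have c4 if c5
    unfolding c4
  proof (intro ballI impI)
    fix f assume f: "f \<in> ?A" "?pos f"
    have rc: "T g x = - (g x)\<^sup>2 * T (\<lambda>y\<in>I. 1 / g y) x" if "g \<in> ?A" "?pos g" "x \<in> I" for g x
    proof -
      have "?rc g"
        using \<open>c5\<close> that unfolding c5 by blast
      from fun_cong[OF this, of x] show ?thesis
        unfolding restrict_apply'[OF \<open>x \<in> I\<close>] .
    qed
    show "?sq f"
      by (rule T_eqI[OF square[OF f(1)]]) (rule T_square_if_reciprocals[OF rc f])
  qed
  ultimately have "c2 = c1" "c3 = c1" "c4 = c1" "c5 = c1" "c6 = c1" "c7 = c1"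
    by metis+
  then have "\<forall>P \<in> set [c1, c2, c3, c4, c5, c6, c7]. \<forall>Q \<in> set [c1, c2, c3, c4, c5, c6, c7]. P \<longleftrightarrow> Q"
    by simp
  then show ?thesis
    unfolding Let_def c1 c2 c3 c4 c5 c6 c7 leibniz_def .
qed

end
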